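(* Let $g\ge 0$. There exists a bijection between the set of type II maximal chord diagrams with $2g$ chords (on $4g$ points labelled $1,\dots,4g$ in cyclic order, invariant under the reflection whose axis passes through the midpoints of the arc between points $4g$ and $1$ and of the arc between points $2g$ and $2g+1$) and the set of rooted maps with $g$ edges, exactly one vertex and exactly one face on closed (without boundary) surfaces, orientable or non-orientable.
   Context: A chord diagram with $n$ chords is a circle with $2n$ evenly spaced points on its circumference, partitioned into $n$ pairs, each pair joined by a chord; diagrams are labelled (not considered up to symmetry). Gluing the sides of a $2n$-gon according to the chords (each pair of sides glued without a twist) yields a one-face map on a closed orientable surface; the genus of the diagram is the genus of this surface. A diagram with $2g$ chords and genus $g$ is called maximal (equivalently, its traversal along arcs and chord sides forms a single closed walk). A map is a cellular embedding of a connected graph (loops and multiple edges allowed) into a compact connected surface without boundary, orientable or not; it is rooted by distinguishing a flag (a corner at a vertex together with a choice of side/direction), and rooted maps are counted up to homeomorphisms preserving the root. *)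

theory Defs
  imports "HOL-Library.Disjoint_Sets"
begin

section \<open>Orbits\<close>

text \<open>Only used for families \<open>T\<close> of involutions of \<open>A\<close>; then the reflexive transitive
  closure is already symmetric, and the classes are the orbits of the group generated by \<open>T\<close>.\<close>

definition orbits :: "'a set \<Rightarrow> ('a \<Rightarrow> 'a) set \<Rightarrow> 'a set set" where
  "orbits A T = A // {(x, y). x \<in> A \<and> y \<in> A \<and> (\<exists>t\<in>T. y = t x)}\<^sup>*"


section \<open>Chord diagrams and their genus\<close>

definition chord_diagram :: "nat \<Rightarrow> nat set set \<Rightarrow> bool" where
  "chord_diagram n D \<longleftrightarrow> partition_on {1..2 * n} D \<and> (\<forall>c\<in>D. card c = 2)"

text \<open>
  The boundary of the \<open>2n\<close>-gon is cut open at one corner: its corners are \<open>0, \<dots>, 2n\<close> with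
  \<open>0\<close> and \<open>2n\<close> identified, and side \<open>i\<close> (for \<open>1 \<le> i \<le> 2n\<close>) runs from corner \<open>i - 1\<close> to
  corner \<open>i\<close>. For \<open>n = 0\<close> this leaves a single corner, as needed for the sphere.
  A chord \<open>{i, j}\<close> glues side \<open>i\<close> to side \<open>j\<close> without a twist, so that the surface is
  orientable: the start of each side is identified with the end of the other one.
\<close>

definition corner_gluing :: "nat \<Rightarrow> nat set set \<Rightarrow> (nat \<times> nat) set" where
  "corner_gluing n D =
     {(0, 2 * n), (2 * n, 0)}
     \<union> {(i - 1, j) | i j. {i, j} \<in> D} \<union> {(i, j - 1) | i j. {i, j} \<in> D}"

definition glued_vertices :: "nat \<Rightarrow> nat set set \<Rightarrow> nat set set" where
  "glued_vertices n D = {0..2 * n} // (corner_gluing n D)\<^sup>*"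

text \<open>The glued surface has a cell decomposition with \<open>n\<close> edges and one face; its genus \<open>h\<close> is
  given by the Euler characteristic \<open>V - n + 1 = 2 - 2h\<close>.\<close>

definition has_genus :: "nat \<Rightarrow> nat set set \<Rightarrow> nat \<Rightarrow> bool" where
  "has_genus n D h \<longleftrightarrow> int (card (glued_vertices n D)) - int n + 1 = 2 - 2 * int h"

definition maximal_diagram :: "nat \<Rightarrow> nat set set \<Rightarrow> bool" where
  "maximal_diagram g D \<longleftrightarrow> chord_diagram (2 * g) D \<and> has_genus (2 * g) D g"

text \<open>The reflection whose axis passes through the midpoint of the arc between \<open>4g\<close> and \<open>1\<close> and
  the midpoint of the arc between \<open>2g\<close> and \<open>2g + 1\<close>.\<close>

definition reflection :: "nat \<Rightarrow> nat \<Rightarrow> nat" where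
  "reflection g i = 4 * g + 1 - i"

definition type_II_maximal_diagrams :: "nat \<Rightarrow> nat set set set" where
  "type_II_maximal_diagrams g =
     {D. maximal_diagram g D \<and> (\<lambda>c. reflection g ` c) ` D = D}"


section \<open>Rooted maps on closed surfaces\<close>

text \<open>
  Maps on closed surfaces, orientable or not, are given by their flags. A flag is a corner at a
  vertex together with a choice of one of the two directions around the vertex; equivalently,
  if there are edges, it is one end of an edge together with one side of that edge (the first
  edge bounding the corner in the chosen direction, seen from the corner).
  The cellular embedding is recorded by three involutions on the flags:
  \<^item> \<open>other_end\<close> moves to the other end of the same edge, staying on the same side of it,
    hence in the same face;
  \<^item> \<open>other_dir\<close> stays in the same corner and reverses the direction;
  \<^item> \<open>other_side\<close> moves to the other side of the same edge, staying at the same end of it,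
    hence at the same vertex.

  All three are fixed-point free: for \<open>other_side\<close> and \<open>other_dir\<close> this excludes boundary.
  The sole exception is the map without edges (one vertex on the sphere): it has one corner and
  hence two flags, but no edge to move along, and there \<open>other_end\<close> and \<open>other_side\<close> are the
  identity.
\<close>

record 'a surface_map =
  flags :: "'a set"
  other_end :: "'a \<Rightarrow> 'a"
  other_dir :: "'a \<Rightarrow> 'a"
  other_side :: "'a \<Rightarrow> 'a"

definition involution_on :: "'a set \<Rightarrow> ('a \<Rightarrow> 'a) \<Rightarrow> bool" where
  "involution_on A t \<longleftrightarrow> (\<forall>x\<in>A. t x \<in> A \<and> t (t x) = x)"

definition is_map :: "'a surface_map \<Rightarrow> bool" where
  "is_map M \<longleftrightarrow>
     finite (flags M) \<and>
     involution_on (flags M) (other_end M) \<and>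
     involution_on (flags M) (other_dir M) \<and>
     involution_on (flags M) (other_side M) \<and>
     (\<forall>x\<in>flags M. other_end M (other_side M x) = other_side M (other_end M x)) \<and>
     (\<forall>x\<in>flags M. other_dir M x \<noteq> x) \<and>
     ((\<forall>x\<in>flags M. other_end M x \<noteq> x \<and> other_side M x \<noteq> x \<and> other_end M (other_side M x) \<noteq> x)
      \<or> (\<forall>x\<in>flags M. other_end M x = x \<and> other_side M x = x)) \<and>
     card (orbits (flags M) {other_end M, other_dir M, other_side M}) = 1"

definition map_vertices :: "'a surface_map \<Rightarrow> 'a set set" where
  "map_vertices M = orbits (flags M) {other_dir M, other_side M}"

definition map_edges :: "'a surface_map \<Rightarrow> 'a set set" where
  "map_edges M = orbits {x \<in> flags M. other_end M x \<noteq> x} {other_end M, other_side M}"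

definition map_faces :: "'a surface_map \<Rightarrow> 'a set set" where
  "map_faces M = orbits (flags M) {other_end M, other_dir M}"

text \<open>A rooted map is a map together with a root flag.\<close>

definition is_rooted_map :: "'a surface_map \<times> 'a \<Rightarrow> bool" where
  "is_rooted_map R \<longleftrightarrow> is_map (fst R) \<and> snd R \<in> flags (fst R)"

text \<open>Two rooted maps are related by a root-preserving homeomorphism iff there is a bijection of
  the flags that respects the three involutions and the roots. Orientation-reversing
  homeomorphisms are allowed.\<close>

definition rooted_map_iso :: "'a surface_map \<times> 'a \<Rightarrow> 'a surface_map \<times> 'a \<Rightarrow> bool" where
  "rooted_map_iso R S \<longleftrightarrow>
     (let M = fst R; N = fst S in
      \<exists>h. bij_betw h (flags M) (flags N) \<and> h (snd R) = snd S \<and>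
          (\<forall>x\<in>flags M. h (other_end M x) = other_end N (h x) \<and>
                        h (other_dir M x) = other_dir N (h x) \<and>
                        h (other_side M x) = other_side N (h x)))"

text \<open>Maps have finitely many flags, so flags taken from \<open>nat\<close> represent every isomorphism class.\<close>

definition rooted_map_reps :: "nat \<Rightarrow> nat \<Rightarrow> nat \<Rightarrow> (nat surface_map \<times> nat) set" where
  "rooted_map_reps v e f =
     {R. is_rooted_map R \<and> card (map_vertices (fst R)) = v \<and>
         card (map_edges (fst R)) = e \<and> card (map_faces (fst R)) = f}"

definition rooted_maps :: "nat \<Rightarrow> nat \<Rightarrow> nat \<Rightarrow> (nat surface_map \<times> nat) set set" where
  "rooted_maps v e f =
     rooted_map_reps v e f //
       {(R, S). R \<in> rooted_map_reps v e f \<and> S \<in> rooted_map_reps v e f \<and> rooted_map_iso R S}"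

end

theory Submission
  imports Defs
begin

text \<open>
  Let \<open>r\<close> be the reflection, acting on the \<open>4g\<close> sides, and let \<open>s\<close> be the same reflection acting
  on the \<open>4g\<close> corners, which fixes exactly two of them. With corner \<open>i\<close> taken to be the end of
  side \<open>i\<close>, the rotation \<open>i \<mapsto> i + 1\<close> is \<open>r \<circ> s\<close>. If the chords are given by the involution \<open>p\<close>, the
  corners are glued along \<open>p \<circ> r \<circ> s = t \<circ> s\<close>, where \<open>t = p \<circ> r\<close> is an involution since \<open>p\<close> commutes
  with \<open>r\<close>. Let \<open>d\<close> agree with \<open>s\<close> except that it swaps the two fixed points. The
  involutions \<open>r, s\<close> generate a path through all labels between the two fixed points of \<open>s\<close>, and
  \<open>d\<close> closes it to a cycle; likewise \<open>t, s\<close> generate such a path, closed to a cycle by \<open>d\<close>, iff the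
  diagram is maximal. So \<open>r, d, t\<close> (other end, other direction, other side) are the involutions of a
  map with one face and one vertex. Conversely, the flags of such a map with \<open>g > 0\<close> edges are
  numbered in a unique way by walking around the face from the root \<open>4g\<close>.
\<close>

section \<open>Transitivity\<close>

text \<open>Only forward closure under \<open>T\<close> is asked of \<open>B\<close>. For
  permutations of a finite set this already amounts to closure under the generated group, so the
  notion serves both for families of involutions and for one cyclic permutation.\<close>

definition transitive_on :: "'a set \<Rightarrow> ('a \<Rightarrow> 'a) set \<Rightarrow> bool" where
  "transitive_on A T \<longleftrightarrow>
     A \<noteq> {} \<and> (\<forall>B\<subseteq>A. B \<noteq> {} \<longrightarrow> (\<forall>t\<in>T. t ` B \<subseteq> B) \<longrightarrow> B = A)"

lemma transitive_onD:
  assumes "transitive_on A T" "B \<subseteq> A" "x \<in> B" "\<And>t y. t \<in> T \<Longrightarrow> y \<in> B \<Longrightarrow> t y \<in> B"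
  shows "B = A"
proof -
  have "B \<noteq> {}" "\<forall>t\<in>T. t ` B \<subseteq> B" using assms(3,4) by auto
  with assms(1,2) show ?thesis unfolding transitive_on_def by meson
qed

lemma transitive_onI:
  assumes "A \<noteq> {}"
    and "\<And>B x. B \<subseteq> A \<Longrightarrow> x \<in> B \<Longrightarrow> (\<And>t y. t \<in> T \<Longrightarrow> y \<in> B \<Longrightarrow> t y \<in> B) \<Longrightarrow> B = A"
  shows "transitive_on A T"
  unfolding transitive_on_def
proof (intro conjI allI impI)
  fix B assume B: "B \<subseteq> A" "B \<noteq> {}" "\<forall>t\<in>T. t ` B \<subseteq> B"
  then obtain x where "x \<in> B" by auto
  show "B = A" by (rule assms(2)[OF B(1) \<open>x \<in> B\<close>]) (use B(3) in auto)
qed (fact assms(1))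

lemma transitive_on_mono:
  assumes "transitive_on A T" "T \<subseteq> U"
  shows "transitive_on A U"
  using assms unfolding transitive_on_def by blast

text \<open>If there is one class, a nonempty \<open>R\<close>-closed set contains everything that a
  path from one of its points reaches, hence all of \<open>A\<close>. Conversely, the class of any
  point is itself nonempty and \<open>R\<close>-closed. Counting classes, of flags or of glued
  corners, thus becomes a question about closed sets.\<close>

lemma card_quotient_rtrancl_eq_1:
  assumes R: "R \<subseteq> A \<times> A"
  shows "card (A // R\<^sup>*) = 1 \<longleftrightarrow> A \<noteq> {} \<and> (\<forall>B\<subseteq>A. B \<noteq> {} \<longrightarrow> R `` B \<subseteq> B \<longrightarrow> B = A)"
proof
  assume one: "card (A // R\<^sup>*) = 1"
  then obtain C where C: "A // R\<^sup>* = {C}" by (metis card_1_singletonE)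
  have cls: "R\<^sup>* `` {x} = C" if "x \<in> A" for x
    using C that by (auto simp: quotient_def)
  have conn: "(x, y) \<in> R\<^sup>*" if "x \<in> A" "y \<in> A" for x y
    using cls[OF that(1)] cls[OF that(2)] by blast
  show "A \<noteq> {} \<and> (\<forall>B\<subseteq>A. B \<noteq> {} \<longrightarrow> R `` B \<subseteq> B \<longrightarrow> B = A)"
  proof (intro conjI allI impI)
    show "A \<noteq> {}" using C by auto
  next
    fix B assume B: "B \<subseteq> A" "B \<noteq> {}" "R `` B \<subseteq> B"
    then obtain x where x: "x \<in> B" by auto
    have "y \<in> B" if "(x, y) \<in> R\<^sup>*" for y
      using that by (induction rule: rtrancl_induct) (use B(3) x in auto)
    then show "B = A" using conn x B(1) by blast
  qed
next
  assume *: "A \<noteq> {} \<and> (\<forall>B\<subseteq>A. B \<noteq> {} \<longrightarrow> R `` B \<subseteq> B \<longrightarrow> B = A)"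
  have cls: "R\<^sup>* `` {x} = A" if x: "x \<in> A" for x
  proof -
    have "y \<in> A" if "(x, y) \<in> R\<^sup>*" for y
      using that by (induction rule: rtrancl_induct) (use R x in auto)
    then have "R\<^sup>* `` {x} \<subseteq> A" by blast
    moreover have "R `` (R\<^sup>* `` {x}) \<subseteq> R\<^sup>* `` {x}" by (auto intro: rtrancl_into_rtrancl)
    ultimately show ?thesis using * by blast
  qed
  then have "A // R\<^sup>* = {A}" using * by (auto simp: quotient_def)
  then show "card (A // R\<^sup>*) = 1" by simp
qed

lemma card_orbits_eq_1:
  assumes "\<And>t. t \<in> T \<Longrightarrow> involution_on A t"
  shows "card (orbits A T) = 1 \<longleftrightarrow> transitive_on A T"
proof -
  let ?R = "{(x, y). x \<in> A \<and> y \<in> A \<and> (\<exists>t\<in>T. y = t x)}"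
  have "?R `` B \<subseteq> B \<longleftrightarrow> (\<forall>t\<in>T. t ` B \<subseteq> B)" if "B \<subseteq> A" for B
    using assms that unfolding involution_on_def by blast
  moreover have "?R \<subseteq> A \<times> A" by auto
  ultimately show ?thesis
    unfolding orbits_def transitive_on_def by (subst card_quotient_rtrancl_eq_1) auto
qed

text \<open>The Klein four-group generated by \<open>a\<close> and \<open>b\<close> acts freely.\<close>

lemma card_eq_4_mult_card_orbits:
  assumes fin: "finite A" and a: "involution_on A a" and b: "involution_on A b"
    and comm: "\<And>x. x \<in> A \<Longrightarrow> a (b x) = b (a x)"
    and free: "\<And>x. x \<in> A \<Longrightarrow> a x \<noteq> x" "\<And>x. x \<in> A \<Longrightarrow> b x \<noteq> x" "\<And>x. x \<in> A \<Longrightarrow> a (b x) \<noteq> x"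
  shows "card A = 4 * card (orbits A {a, b})"
proof -
  let ?R = "{(x, y). x \<in> A \<and> y \<in> A \<and> (\<exists>t\<in>{a, b}. y = t x)}"
  let ?K = "\<lambda>x. {x, a x, b x, a (b x)}"
  have A [simp]: "a x \<in> A" "b x \<in> A" "a (a x) = x" "b (b x) = x" if "x \<in> A" for x
    using a b that by (auto simp: involution_on_def)
  have cls: "?R\<^sup>* `` {x} = ?K x" if x: "x \<in> A" for x
  proof (rule equalityI; rule subsetI)
    fix y assume "y \<in> ?R\<^sup>* `` {x}"
    then have "(x, y) \<in> ?R\<^sup>*" by simp
    then show "y \<in> ?K x"
    proof (induction rule: rtrancl_induct)
      case (step y z)
      then show ?case using x by (auto simp: comm)
    qed simp
  next
    fix y assume y: "y \<in> ?K x"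
    have "(x, a x) \<in> ?R" "(x, b x) \<in> ?R" "(b x, a (b x)) \<in> ?R" using x by auto
    then have "(x, a x) \<in> ?R\<^sup>*" "(x, b x) \<in> ?R\<^sup>*" "(x, a (b x)) \<in> ?R\<^sup>*"
      by (meson r_into_rtrancl rtrancl_trans)+
    then show "y \<in> ?R\<^sup>* `` {x}" using y by auto
  qed
  have O: "orbits A {a, b} = ?K ` A"
    unfolding orbits_def quotient_def using cls by auto
  have "4 * card (orbits A {a, b}) = card (\<Union> (orbits A {a, b}))"
  proof (rule card_partition)
    show "finite (orbits A {a, b})" using fin by (simp add: O)
    show "finite (\<Union> (orbits A {a, b}))" using fin by (auto simp: O)
  next
    fix c assume "c \<in> orbits A {a, b}"
    then obtain x where x: "x \<in> A" "c = ?K x" by (auto simp: O)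
    have "x \<noteq> a x" "x \<noteq> b x" "x \<noteq> a (b x)" "b x \<noteq> a (b x)" using free x by (metis A)+
    moreover have "a x \<noteq> b x" using free(3) x by (metis A)
    moreover have "a x \<noteq> a (b x)" using free(2) x by (metis A)
    ultimately show "card c = 4" using x by simp
  next
    fix c d assume "c \<in> orbits A {a, b}" "d \<in> orbits A {a, b}" and ne: "c \<noteq> d"
    then obtain x y where xy: "x \<in> A" "c = ?K x" "y \<in> A" "d = ?K y" by (auto simp: O)
    have K: "?K z = ?K u" if "z \<in> A" "u \<in> ?K z" for z u
      using that by (auto simp: comm)
    show "c \<inter> d = {}"
    proof (rule ccontr)
      assume "c \<inter> d \<noteq> {}"
      then obtain u where "u \<in> ?K x" "u \<in> ?K y" using xy by auto
      then have "?K x = ?K y" using K[OF xy(1), of u] K[OF xy(3), of u] by blast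
      then show False using ne xy by simp
    qed
  qed
  moreover have "\<Union> (orbits A {a, b}) = A" by (auto simp: O)
  ultimately show ?thesis by simp
qed

section \<open>Cyclic labelling\<close>

fun walk :: "('a \<Rightarrow> 'a) \<Rightarrow> ('a \<Rightarrow> 'a) \<Rightarrow> 'a \<Rightarrow> nat \<Rightarrow> 'a" where
  "walk a b x 0 = x"
| "walk a b x (Suc k) = (if even k then a else b) (walk a b x k)"

text \<open>In the graph with edges \<open>z - a z\<close> and \<open>z - b z\<close>, a connected
  finite piece is a cycle of even length. Take the first repetition \<open>w i = w j\<close>. The
  last step into \<open>w j\<close> can be reversed from \<open>w i\<close>. If it uses the
  involution that leaves index \<open>i\<close> forwards, then \<open>w (j - 1) = w (i + 1)\<close>;
  if \<open>i > 0\<close> and it uses the one that entered index \<open>i\<close>, then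
  \<open>w (j - 1) = w (i - 1)\<close>. Both contradict the minimality of \<open>j\<close>, the
  former by parity, so \<open>i = 0\<close> and \<open>j\<close> is even.\<close>

lemma walk_bij:
  assumes fin: "finite A" and a: "involution_on A a" and b: "involution_on A b"
    and free: "\<And>x. x \<in> A \<Longrightarrow> a x \<noteq> x" "\<And>x. x \<in> A \<Longrightarrow> b x \<noteq> x"
    and trans: "transitive_on A {a, b}" and x: "x \<in> A"
  shows "bij_betw (walk a b x) {..<card A} A" and "walk a b x (card A) = x"
proof -
  define w where "w = walk a b x"
  have A: "a z \<in> A" "b z \<in> A" "a (a z) = z" "b (b z) = z" if "z \<in> A" for z
    using a b that by (auto simp: involution_on_def)
  have w0: "w 0 = x" by (simp add: w_def)
  have wA: "w k \<in> A" for k by (induction k) (auto simp: w_def x A)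
  have wS: "w (Suc k) = (if even k then a else b) (w k)" for k by (simp add: w_def)
  have wB: "w k = (if even k then a else b) (w (Suc k))" for k using wS[of k] A wA[of k] by auto
  have "\<exists>j. \<exists>i<j. w i = w j"
  proof -
    have "\<not> inj w"
      using fin wA by (meson finite_imageD finite_subset image_subsetI infinite_UNIV_nat)
    then obtain i j where "w i = w j" "i \<noteq> j" by (auto simp: inj_def)
    then show ?thesis by (metis nat_neq_iff)
  qed
  then obtain j where j: "\<exists>i<j. w i = w j" and jmin: "\<And>j'. j' < j \<Longrightarrow> \<not> (\<exists>i<j'. w i = w j')"
    using exists_least_iff[of "\<lambda>j. \<exists>i<j. w i = w j"] by blast
  from j obtain i where i: "i < j" "w i = w j" by blast
  have inj: "inj_on w {..<j}"
    unfolding inj_on_def using jmin by (metis lessThan_iff nat_neq_iff)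
  obtain l where l: "j = Suc l" using i by (cases j) auto
  have il: "i < l"
  proof (rule ccontr)
    assume "\<not> i < l"
    then have "i = l" using i l by simp
    then have "(if even l then a else b) (w l) = w l" using i(2) l wS[of l] by simp
    then show False using free[OF wA[of l]] by (auto split: if_splits)
  qed
  have backw: "w l = (if even l then a else b) (w i)" using wB[of l] i l by simp
  have par: "odd (l - i)"
  proof (rule ccontr)
    assume "\<not> odd (l - i)"
    then have "even l = even i" using il by presburger
    then have "w l = w (Suc i)" using backw wS[of i] by simp
    then have "l = Suc i" using inj il l by (auto simp: inj_on_def)
    then show False using \<open>even l = even i\<close> by simp
  qed
  have i0: "i = 0"
  proof (cases i)
    case (Suc k)
    have "even l = even k" using par il Suc by presburger
    then have "w l = w k" using backw wB[of k] Suc by simp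
    then have "l = k" using inj il l Suc by (auto simp: inj_on_def)
    then show ?thesis using il Suc by simp
  qed
  have odd_l: "odd l" using par i0 by simp
  \<comment> \<open>At each index one involution steps forward and the other backward. At the ends
    this wraps around: as \<open>l\<close> is odd, the last step is made by \<open>b\<close>, the
    one that steps backward from index \<open>0\<close>.\<close>
  have closed: "w ` {..<j} = A"
  proof (rule transitive_onD[OF trans])
    show "w ` {..<j} \<subseteq> A" using wA by auto
    show "x \<in> w ` {..<j}" using w0 l by force
    fix t y assume "t \<in> {a, b}" and "y \<in> w ` {..<j}"
    then obtain k where k: "k < j" "y = w k" by auto
    show "t y \<in> w ` {..<j}"
    proof (cases "t = (if even k then a else b)")
      case True
      then have t: "t y = w (Suc k)" using wS[of k] k by simp
      show ?thesis
      proof (cases "Suc k = j")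
        case True
        then have "t y = w 0" using t i i0 by simp
        then show ?thesis using i(1) i0 by blast
      qed (use t k in auto)
    next
      case False
      then have t': "t = (if even k then b else a)" using \<open>t \<in> {a, b}\<close> by auto
      show ?thesis
      proof (cases k)
        case 0
        then have "t y = w l" using t' k backw odd_l i0 by simp
        then show ?thesis using l by auto
      next
        case (Suc m)
        then have "t y = w m" using t' k wB[of m] by auto
        then show ?thesis using k Suc by auto
      qed
    qed
  qed
  have N: "card A = j" using card_image[OF inj] closed by simp
  show "bij_betw (walk a b x) {..<card A} A"
    using inj closed N by (simp add: bij_betw_def w_def)
  show "walk a b x (card A) = x" using i i0 N w0 by (simp add: w_def)
qed

text \<open>The reflection acts on corners by \<open>i \<mapsto> 4g - i\<close>, where corner \<open>0\<close> is \<open>4g\<close>; it fixes the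
  two corners \<open>2g\<close> and \<open>4g\<close> on the axis, and \<open>corner_dir\<close> swaps these two instead.\<close>

definition corner_reflection :: "nat \<Rightarrow> nat \<Rightarrow> nat" where
  "corner_reflection g i = (if i = 4 * g then i else 4 * g - i)"

definition corner_dir :: "nat \<Rightarrow> nat \<Rightarrow> nat" where
  "corner_dir g i = (if i = 4 * g then 2 * g else if i = 2 * g then 4 * g else 4 * g - i)"

lemma involution_on_reflections:
  "involution_on {1..4 * g} (reflection g)"
  "involution_on {1..4 * g} (corner_reflection g)"
  "involution_on {1..4 * g} (corner_dir g)"
  by (auto simp: involution_on_def reflection_def corner_reflection_def corner_dir_def)

lemma reflection_neq: "i \<in> {1..4 * g} \<Longrightarrow> reflection g i \<noteq> i"
  unfolding reflection_def by simp presburger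

lemma corner_dir_neq: "i \<in> {1..4 * g} \<Longrightarrow> corner_dir g i \<noteq> i"
  by (auto simp: corner_dir_def)

lemma corner_reflection_cases:
  "corner_reflection g i = (if i = 2 * g \<or> i = 4 * g then i else corner_dir g i)"
  by (auto simp: corner_dir_def corner_reflection_def)

lemma reflection_corner_reflection:
  "i \<in> {1..4 * g} \<Longrightarrow> reflection g (corner_reflection g i) = (if i = 4 * g then 1 else Suc i)"
  by (auto simp: reflection_def corner_reflection_def)

lemma transitive_on_rotation:
  assumes "g > 0"
  shows "transitive_on {1..4 * g} {reflection g \<circ> corner_reflection g}"
proof (rule transitive_onI)
  fix B x
  assume B: "B \<subseteq> {1..4 * g}" "x \<in> B"
    and cl: "\<And>t y. t \<in> {reflection g \<circ> corner_reflection g} \<Longrightarrow> y \<in> B \<Longrightarrow> t y \<in> B"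
  have suc: "(if y = 4 * g then 1 else Suc y) \<in> B" if "y \<in> B" for y
    using cl[OF _ that] reflection_corner_reflection[of y g] B(1) that by auto
  have up: "k \<in> B" if "y \<in> B" "y \<le> k" "k \<le> 4 * g" for y k
    using that(2,3)
  proof (induction k rule: dec_induct)
    case (step k)
    then show ?case using suc[of k] by simp
  qed (simp add: that(1))
  have "4 * g \<in> B" using up[OF B(2)] B by auto
  then have "1 \<in> B" using suc by force
  then show "B = {1..4 * g}" using up B(1) by auto
qed (use assms in auto)

text \<open>The maps \<open>corner_dir\<close> and \<open>corner_reflection\<close> differ only at
  the two points fixed by the latter, so a set closed under the former is closed under both. It is
  then closed under the rotation.\<close>

lemma transitive_on_reflection_corner_dir:
  assumes "g > 0"
  shows "transitive_on {1..4 * g} {reflection g, corner_dir g}"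
proof (rule transitive_onI)
  fix B x
  assume B: "B \<subseteq> {1..4 * g}" "x \<in> B"
    and cl: "\<And>t y. t \<in> {reflection g, corner_dir g} \<Longrightarrow> y \<in> B \<Longrightarrow> t y \<in> B"
  show "B = {1..4 * g}"
    by (rule transitive_onD[OF transitive_on_rotation[OF assms] B])
      (use cl in \<open>auto simp: corner_reflection_cases\<close>)
qed (use assms in auto)

text \<open>Two cycles of the same length with alternating edges can be matched once their base
  points are matched. The pair \<open>reflection g\<close>, \<open>corner_dir g\<close> with base
  point \<open>4 * g\<close> therefore models every such pair. This is applied once to the face of a
  map and once to its vertex.\<close>

lemma cyclic_labelling:
  assumes g: "g > 0" and card: "card A = 4 * g"
    and a: "involution_on A a" and b: "involution_on A b"
    and free: "\<And>x. x \<in> A \<Longrightarrow> a x \<noteq> x" "\<And>x. x \<in> A \<Longrightarrow> b x \<noteq> x"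
    and trans: "transitive_on A {a, b}" and x: "x \<in> A"
  obtains h where "bij_betw h {1..4 * g} A" "h (4 * g) = x"
    "\<And>i. i \<in> {1..4 * g} \<Longrightarrow> h (reflection g i) = a (h i)"
    "\<And>i. i \<in> {1..4 * g} \<Longrightarrow> h (corner_dir g i) = b (h i)"
proof
  let ?w = "walk a b x"
  \<comment> \<open>The position of a label in the model walk
    \<open>4g, 1, 4g - 1, 2, 4g - 2, ..., 2g\<close>, whose steps are alternately
    \<open>reflection g\<close> and \<open>corner_dir g\<close>.\<close>
  let ?f = "\<lambda>i. if i \<le> 2 * g then 2 * i - 1 else 2 * (4 * g - i)"
  let ?h = "\<lambda>i. ?w (?f i)"
  have fin: "finite A" using card g by (metis card.infinite mult_is_0 neq0_conv zero_neq_numeral)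
  note w = walk_bij[OF fin a b free trans x, unfolded card]
  have wA: "?w k \<in> A" for k
    using a b x by (induction k) (auto simp: involution_on_def)
  have wB: "?w k = (if even k then a else b) (?w (Suc k))" for k
    using a b wA[of k] by (auto simp: involution_on_def)
  have "bij_betw ?f {1..4 * g} {..<4 * g}"
    by (rule bij_betw_byWitness[where f' = "\<lambda>k. if odd k then (k + 1) div 2 else 4 * g - k div 2"])
      (auto elim!: oddE evenE)
  from bij_betw_trans[OF this w(1)] show "bij_betw ?h {1..4 * g} A" by (simp add: comp_def)
  show "?h (4 * g) = x" using g by simp
  fix i assume i: "i \<in> {1..4 * g}"
  show "?h (reflection g i) = a (?h i)"
  proof (cases "i \<le> 2 * g")
    case True
    then have "?f i = Suc (?f (reflection g i))" "even (?f (reflection g i))"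
      using i by (auto simp: reflection_def)
    then show ?thesis using wB[of "?f (reflection g i)"] by simp
  next
    case False
    then have "?f (reflection g i) = Suc (?f i)" "even (?f i)"
      using i by (auto simp: reflection_def)
    then show ?thesis by simp
  qed
  \<comment> \<open>The two axis corners are the first and the last label of the model walk and use
    that it closes up. Every other label is adjacent in the walk to its image under
    \<open>corner_dir g\<close>.\<close>
  consider "i = 4 * g" | "i = 2 * g" | "i < 2 * g" | "2 * g < i" "i < 4 * g" using i by force
  then show "?h (corner_dir g i) = b (?h i)"
  proof cases
    case 1
    have "?f (corner_dir g i) = 4 * g - 1" "?f i = 0" using 1 g by (auto simp: corner_dir_def)
    moreover have "Suc (4 * g - 1) = 4 * g" "odd (4 * g - 1)" using g by auto
    ultimately show ?thesis using wB[of "4 * g - 1"] w(2) by simp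
  next
    case 2
    have "?f i = 4 * g - 1" "?f (corner_dir g i) = 0" using 2 g by (auto simp: corner_dir_def)
    moreover have "Suc (4 * g - 1) = 4 * g" "odd (4 * g - 1)" using g by auto
    ultimately show ?thesis using w(2) walk.simps(2)[of a b x "4 * g - 1"] by simp
  next
    case 3
    then have "?f (corner_dir g i) = Suc (?f i)" "odd (?f i)"
      using i by (auto simp: corner_dir_def)
    then show ?thesis by simp
  next
    case 4
    then have "?f i = Suc (?f (corner_dir g i))" "odd (?f (corner_dir g i))"
      using i by (auto simp: corner_dir_def)
    then show ?thesis using wB[of "?f (corner_dir g i)"] by simp
  qed
qed

text \<open>If \<open>t\<close> had a fixed point, then the cyclic permutation \<open>t \<circ> s\<close>, which is inverted by both
  \<open>s\<close> and \<open>t\<close>, would have odd order.\<close>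

lemma fixed_point_free_if_transitive:
  assumes fin: "finite A" and ev: "even (card A)"
    and s: "involution_on A s" and t: "involution_on A t"
    and trans: "transitive_on A {t \<circ> s}" and p: "p \<in> A" "s p = p" and x: "x \<in> A"
  shows "t x \<noteq> x"
proof
  assume tx: "t x = x"
  define f where "f = t \<circ> s"
  have A: "s z \<in> A" "t z \<in> A" "s (s z) = z" "t (t z) = z" if "z \<in> A" for z
    using s t that by (auto simp: involution_on_def)
  have fA: "(f ^^ k) z \<in> A" if "z \<in> A" for k z
    using that by (induction k) (auto simp: f_def A)
  have fsf: "f (s (f z)) = s z" if "z \<in> A" for z
    using that by (simp add: f_def A)
  \<comment> \<open>As \<open>f \<circ> s \<circ> f = s\<close> on \<open>A\<close>, also
    \<open>f^k \<circ> s \<circ> f^k = s\<close>, and \<open>s\<close> fixes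
    \<open>p\<close>.\<close>
  have backw: "(f ^^ k) (s ((f ^^ k) p)) = p" for k
  proof (induction k)
    case (Suc k)
    have "(f ^^ Suc k) (s ((f ^^ Suc k) p)) = (f ^^ k) (f (s (f ((f ^^ k) p))))"
      by (simp only: funpow_Suc_right o_apply) (simp add: funpow_swap1)
    also have "\<dots> = p" using fsf[OF fA[OF p(1)]] Suc by simp
    finally show ?case .
  qed (simp add: p)
  have "(\<lambda>k. (f ^^ k) p) ` UNIV = A"
  proof (rule transitive_onD[OF trans])
    show "(\<lambda>k. (f ^^ k) p) ` UNIV \<subseteq> A" using fA p by auto
    show "p \<in> (\<lambda>k. (f ^^ k) p) ` UNIV" by (rule image_eqI[of _ _ 0]) auto
    fix u y assume "u \<in> {t \<circ> s}" "y \<in> (\<lambda>k. (f ^^ k) p) ` UNIV"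
    then obtain k where "u = f" "y = (f ^^ k) p" by (auto simp: f_def)
    then have "u y = (f ^^ Suc k) p" by simp
    then show "u y \<in> (\<lambda>k. (f ^^ k) p) ` UNIV" by blast
  qed
  then obtain k where k: "x = (f ^^ k) p" using x by auto
  have fx: "f (s x) = x" using tx x by (simp add: f_def A)
  \<comment> \<open>With \<open>x = f^k p\<close>, the previous facts give
    \<open>f^k (s x) = p\<close> and \<open>f (s x) = x\<close>. Hence \<open>p\<close> returns
    after \<open>2k - 1\<close> steps, or after one step if \<open>k = 0\<close>.\<close>
  have "\<exists>m. odd m \<and> (f ^^ m) p = p"
  proof (cases k)
    case 0
    then have "f p = p" using k tx p by (simp add: f_def)
    then show ?thesis by (intro exI[of _ 1]) simp
  next
    case (Suc l)
    have "(f ^^ (l + k)) p = (f ^^ l) (f (s x))" using fx k by (simp add: funpow_add)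
    also have "\<dots> = (f ^^ k) (s x)" using Suc by (simp add: funpow_swap1)
    also have "\<dots> = p" using backw k by simp
    finally show ?thesis using Suc by (intro exI[of _ "l + k"]) simp
  qed
  then obtain m where m: "odd m" "(f ^^ m) p = p" by blast
  \<comment> \<open>The exact period of \<open>p\<close> divides the odd number \<open>m\<close>;
    since the orbit of \<open>p\<close> is all of \<open>A\<close>, it also equals the even number
    \<open>card A\<close>.\<close>
  define d where "d = (LEAST d. 0 < d \<and> (f ^^ d) p = p)"
  have d: "0 < d" "(f ^^ d) p = p"
    using LeastI[of "\<lambda>d. 0 < d \<and> (f ^^ d) p = p" m] m unfolding d_def
    by (auto intro: odd_pos)
  have dmin: "(f ^^ e) p \<noteq> p" if "0 < e" "e < d" for e
    using not_less_Least[of e "\<lambda>d. 0 < d \<and> (f ^^ d) p = p"] that unfolding d_def by auto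
  have "(f ^^ (m mod d)) p = p" using funpow_mod_eq[OF d(2)] m(2) by simp
  then have "m mod d = 0" using dmin d(1) by (metis gr0I mod_less_divisor)
  then have "odd d" using m(1) by (metis dvd_trans mod_0_imp_dvd)
  have "(\<lambda>k. (f ^^ k) p) ` {0..<d} = A"
  proof (rule transitive_onD[OF trans])
    show "(\<lambda>k. (f ^^ k) p) ` {0..<d} \<subseteq> A" using fA p by auto
    show "p \<in> (\<lambda>k. (f ^^ k) p) ` {0..<d}" by (rule image_eqI[of _ _ 0]) (use d in auto)
    fix u y assume "u \<in> {t \<circ> s}" "y \<in> (\<lambda>k. (f ^^ k) p) ` {0..<d}"
    then obtain k where "u = f" "y = (f ^^ k) p" by (auto simp: f_def)
    then have "u y = (f ^^ (Suc k mod d)) p" using funpow_mod_eq[OF d(2)] by simp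
    then show "u y \<in> (\<lambda>k. (f ^^ k) p) ` {0..<d}" using d(1) by simp
  qed
  then have "card A = d"
    using card_image[OF inj_on_funpow_least[OF d(2) dmin]] by simp
  then show False using ev \<open>odd d\<close> by simp
qed

section \<open>Chord diagrams as involutions\<close>

definition partner :: "nat set set \<Rightarrow> nat \<Rightarrow> nat" where
  "partner D i = (THE j. {i, j} \<in> D)"

lemma chord_iff_partner:
  assumes D: "chord_diagram n D"
  shows "{i, j} \<in> D \<longleftrightarrow> i \<in> {1..2 * n} \<and> j = partner D i"
proof -
  have part: "partition_on {1..2 * n} D" and two: "\<And>c. c \<in> D \<Longrightarrow> card c = 2"
    using D by (auto simp: chord_diagram_def)
  have uniq: "j = k" if "{i, j} \<in> D" "{i, k} \<in> D" for j k
  proof -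
    have "{i, j} = {i, k}"
    proof (rule ccontr)
      assume "{i, j} \<noteq> {i, k}"
      from disjointD[OF partition_onD2[OF part] that this] show False by simp
    qed
    then show ?thesis by (metis doubleton_eq_iff)
  qed
  have mem: "i \<in> {1..2 * n}" if "{i, j} \<in> D" for j
    using partition_onD1[OF part] that by auto
  have ex: "{i, partner D i} \<in> D" if i: "i \<in> {1..2 * n}"
  proof -
    obtain c where c: "c \<in> D" "i \<in> c" using partition_onD1[OF part] i by auto
    obtain k l where kl: "c = {k, l}" using two[OF c(1)] by (meson card_2_iff)
    then have "\<exists>j. {i, j} = c" using c(2) by (cases "i = k") auto
    then obtain j where j: "{i, j} \<in> D" using c(1) by metis
    show ?thesis unfolding partner_def by (rule theI[of _ j]) (use j uniq in blast)+
  qed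
  show ?thesis
  proof
    assume ij: "{i, j} \<in> D"
    show "i \<in> {1..2 * n} \<and> j = partner D i" using mem[OF ij] uniq[OF ij ex] by blast
  next
    assume "i \<in> {1..2 * n} \<and> j = partner D i"
    then show "{i, j} \<in> D" using ex by simp
  qed
qed

lemma involution_on_partner:
  assumes D: "chord_diagram n D"
  shows "involution_on {1..2 * n} (partner D)"
  unfolding involution_on_def
proof
  fix i assume "i \<in> {1..2 * n}"
  then have "{partner D i, i} \<in> D"
    using chord_iff_partner[OF D, of i "partner D i"] by (simp add: insert_commute)
  then show "partner D i \<in> {1..2 * n} \<and> partner D (partner D i) = i"
    using chord_iff_partner[OF D, of "partner D i" i] by simp
qed

lemma partner_neq:
  assumes D: "chord_diagram n D" and i: "i \<in> {1..2 * n}"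
  shows "partner D i \<noteq> i"
proof
  assume "partner D i = i"
  then have "{i} \<in> D" using chord_iff_partner[OF D, of i i] i by simp
  then have "card {i} = 2" using D unfolding chord_diagram_def by blast
  then show False by simp
qed

lemma chord_diagram_eq_image_partner:
  assumes D: "chord_diagram n D"
  shows "D = (\<lambda>i. {i, partner D i}) ` {1..2 * n}"
proof (rule equalityI; rule subsetI)
  fix c assume c: "c \<in> D"
  then obtain i j where "c = {i, j}" using D by (auto simp: chord_diagram_def card_2_iff)
  then show "c \<in> (\<lambda>i. {i, partner D i}) ` {1..2 * n}"
    using chord_iff_partner[OF D, of i j] c by auto
next
  fix c assume "c \<in> (\<lambda>i. {i, partner D i}) ` {1..2 * n}"
  then show "c \<in> D" using chord_iff_partner[OF D] by blast
qed

lemma chord_diagram_of_involution: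
  assumes p: "involution_on {1..2 * n} p" and free: "\<And>i. i \<in> {1..2 * n} \<Longrightarrow> p i \<noteq> i"
  defines "D \<equiv> (\<lambda>i. {i, p i}) ` {1..2 * n}"
  shows "chord_diagram n D" and "\<And>i. i \<in> {1..2 * n} \<Longrightarrow> partner D i = p i"
proof -
  have pA: "p i \<in> {1..2 * n}" "p (p i) = i" if "i \<in> {1..2 * n}" for i
    using p that by (auto simp: involution_on_def)
  have same: "{i, p i} = {j, p j}" if "i \<in> {1..2 * n}" "j \<in> {1..2 * n}" "k \<in> {i, p i}" "k \<in> {j, p j}" for i j k
  proof -
    have "{m, p m} = {k, p k}" if "m \<in> {1..2 * n}" "k \<in> {m, p m}" for m
      using that pA(2)[of m] by auto
    then show ?thesis using that by metis
  qed
  show D: "chord_diagram n D"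
    unfolding chord_diagram_def
  proof (intro conjI ballI partition_onI)
    show "\<Union> D = {1..2 * n}" using pA by (auto simp: D_def)
    show "{} \<notin> D" by (auto simp: D_def)
    fix c assume c: "c \<in> D"
    then show "card c = 2" using free by (force simp: D_def)
    fix d assume "d \<in> D" "c \<noteq> d"
    then show "disjnt c d" using c same unfolding D_def disjnt_def by blast
  qed
  fix i assume "i \<in> {1..2 * n}"
  then have "{i, p i} \<in> D" by (simp add: D_def)
  then show "partner D i = p i" using chord_iff_partner[OF D] by simp
qed

section \<open>Corner gluing as a walk around the vertex\<close>

lemma corner_gluing_eq:
  assumes D: "chord_diagram n D"
  shows "corner_gluing n D = {(0, 2 * n), (2 * n, 0)}
    \<union> (\<lambda>i. (i - 1, partner D i)) ` {1..2 * n} \<union> (\<lambda>i. (i, partner D i - 1)) ` {1..2 * n}"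
proof -
  have "{(i - 1, j) | i j. {i, j} \<in> D} = (\<lambda>i. (i - 1, partner D i)) ` {1..2 * n}"
    "{(i, j - 1) | i j. {i, j} \<in> D} = (\<lambda>i. (i, partner D i - 1)) ` {1..2 * n}"
    unfolding chord_iff_partner[OF D] by blast+
  then show ?thesis unfolding corner_gluing_def by (simp only:)
qed

text \<open>Corner \<open>c\<close> ends side \<open>c\<close> and starts the next side, whose start
  is glued to the end of its partner. Hence one family of gluings is the map \<open>f\<close> below
  and the other is its inverse, with corner \<open>0\<close> as a second copy of corner
  \<open>2 * n\<close>. Closed sets of corners then correspond to \<open>f\<close>-closed subsets of
  \<open>{1..2 * n}\<close>.\<close>

lemma card_glued_vertices_eq_1:
  assumes D: "chord_diagram n D" and n: "n > 0"
  shows "card (glued_vertices n D) = 1 \<longleftrightarrow>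
    transitive_on {1..2 * n} {\<lambda>c. partner D (if c = 2 * n then 1 else Suc c)}"
proof -
  let ?A = "{1..2 * n}" and ?C = "{0..2 * n}" and ?G = "corner_gluing n D"
  define nxt where "nxt c = (if c = 2 * n then 1 else Suc c)" for c
  define f where "f c = partner D (nxt c)" for c
  note G = corner_gluing_eq[OF D]
  have p: "partner D i \<in> ?A" "partner D (partner D i) = i" if "i \<in> ?A" for i
    using involution_on_partner[OF D] that by (auto simp: involution_on_def)
  have next_A: "nxt c \<in> ?A" if "c \<in> ?A" for c using that by (auto simp: nxt_def)
  have fA: "f c \<in> ?A" if "c \<in> ?A" for c
    unfolding f_def using p(1)[OF next_A[OF that]] .
  have "partner D i \<in> ?C" if "i \<in> ?A" for i using p(1)[OF that] by simp
  then have "?G \<subseteq> ?C \<times> ?C" unfolding G by (force simp: le_diff_conv intro: le_SucI)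
  then have "card (glued_vertices n D) = 1 \<longleftrightarrow> (\<forall>B\<subseteq>?C. B \<noteq> {} \<longrightarrow> ?G `` B \<subseteq> B \<longrightarrow> B = ?C)"
    unfolding glued_vertices_def by (subst card_quotient_rtrancl_eq_1) auto
  also have "\<dots> \<longleftrightarrow> transitive_on ?A {f}"
  proof
    assume conn: "\<forall>B\<subseteq>?C. B \<noteq> {} \<longrightarrow> ?G `` B \<subseteq> B \<longrightarrow> B = ?C"
    show "transitive_on ?A {f}"
    proof (rule transitive_onI)
      fix B x assume B: "B \<subseteq> ?A" "x \<in> B" and cl: "\<And>t y. t \<in> {f} \<Longrightarrow> y \<in> B \<Longrightarrow> t y \<in> B"
      have inj: "inj_on f ?A"
      proof (rule inj_onI)
        fix c d assume cd: "c \<in> ?A" "d \<in> ?A" "f c = f d"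
        have "nxt c = partner D (f c)" using p(2)[OF next_A[OF cd(1)]] by (simp add: f_def)
        also have "\<dots> = partner D (f d)" using cd(3) by simp
        also have "\<dots> = nxt d" using p(2)[OF next_A[OF cd(2)]] by (simp add: f_def)
        finally have "nxt c = nxt d" .
        then show "c = d" using cd(1,2) unfolding nxt_def atLeastAtMost_iff by presburger
      qed
      have surj: "f ` B = B"
      proof (rule endo_inj_surj)
        show "finite B" by (rule finite_subset[OF B(1)]) simp
        show "f ` B \<subseteq> B" using cl by blast
        show "inj_on f B" by (rule inj_on_subset[OF inj B(1)])
      qed
      have pred: "c \<in> B" if "f c \<in> B" "c \<in> ?A" for c
      proof -
        from that(1) surj have "f c \<in> f ` B" by simp
        then obtain d where d: "d \<in> B" "f c = f d" by (rule imageE) (rule that)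
        then show ?thesis using inj_onD[OF inj d(2)] B(1) that(2) by blast
      qed
      have fB: "f y \<in> B" if "y \<in> B" for y using cl that by blast
      \<comment> \<open>The copy \<open>0\<close> must join exactly when \<open>2 * n\<close> is
        present, as these two are glued.\<close>
      define B' where "B' = B \<union> (if 2 * n \<in> B then {0} else {})"
      have B': "i \<in> B' \<longleftrightarrow> i \<in> B \<or> i = 0 \<and> 2 * n \<in> B" for i by (simp add: B'_def)
      have "0 \<notin> B" using B(1) by auto
      have start: "partner D i \<in> B'" if "i \<in> ?A" "i - 1 \<in> B'" for i
      proof (cases "i = 1")
        case True
        then have "2 * n \<in> B" using that(2) \<open>0 \<notin> B\<close> by (simp add: B')
        then show ?thesis using fB[of "2 * n"] True by (simp add: f_def nxt_def B')
      next
        case False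
        have "i - 1 \<noteq> 0" using False that(1) by auto
        then have "i - 1 \<in> B" using that(2) by (simp add: B')
        moreover have "nxt (i - 1) = i" using False that(1) by (auto simp: nxt_def)
        ultimately show ?thesis using fB[of "i - 1"] by (simp add: f_def B')
      qed
      have finish: "partner D i - 1 \<in> B'" if i: "i \<in> ?A" "i \<in> B'" for i
      proof -
        have iB: "i \<in> B" using i by (simp add: B')
        have "partner D i \<in> ?A" using p i by blast
        show ?thesis
        proof (cases "partner D i = 1")
          case True
          then have "f (2 * n) = i" using p(2)[OF i(1)] by (simp add: f_def nxt_def)
          then have "2 * n \<in> B" using pred[of "2 * n"] iB n by auto
          then show ?thesis using True by (simp add: B')
        next
          case False
          then have "f (partner D i - 1) = i" "partner D i - 1 \<in> ?A"
            using p(2)[OF i(1)] \<open>partner D i \<in> ?A\<close> by (auto simp: f_def nxt_def)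
          then show ?thesis using pred[of "partner D i - 1"] iB by (simp add: B')
        qed
      qed
      have "B' \<subseteq> ?C" "B' \<noteq> {}" using B by (auto simp: B')
      moreover have "?G `` B' \<subseteq> B'"
      proof (rule subsetI)
        fix d assume "d \<in> ?G `` B'"
        then obtain c where c: "(c, d) \<in> ?G" "c \<in> B'" by (rule ImageE)
        from c(1) consider "c = 0" "d = 2 * n" | "c = 2 * n" "d = 0"
          | i where "i \<in> ?A" "c = i - 1" "d = partner D i"
          | i where "i \<in> ?A" "c = i" "d = partner D i - 1"
          unfolding G by blast
        then show "d \<in> B'"
          using start finish c(2) \<open>0 \<notin> B\<close> by cases (auto simp: B')
      qed
      ultimately have eq: "B' = ?C" using conn by blast
      have "y \<in> B" if "y \<in> ?A" for y
      proof -
        have "y \<in> B'" "y \<noteq> 0" using that by (auto simp: eq)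
        then show ?thesis by (simp add: B')
      qed
      then show "B = ?A" using B(1) by blast
    qed (use n in auto)
  next
    assume tr: "transitive_on ?A {f}"
    show "\<forall>B\<subseteq>?C. B \<noteq> {} \<longrightarrow> ?G `` B \<subseteq> B \<longrightarrow> B = ?C"
    proof (intro allI impI)
      fix B assume B: "B \<subseteq> ?C" "B \<noteq> {}" "?G `` B \<subseteq> B"
      have step: "d \<in> B" if "(c, d) \<in> ?G" "c \<in> B" for c d using B(3) that by blast
      have ends: "0 \<in> B \<longleftrightarrow> 2 * n \<in> B" using step[of 0 "2 * n"] step[of "2 * n" 0] by (auto simp: G)
      obtain x where "x \<in> B" using B(2) by auto
      \<comment> \<open>If the chosen corner is \<open>0\<close>, its copy \<open>2 * n\<close>
        replaces it, so that the starting point lies in \<open>?A\<close>.\<close>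
      then have x: "(if x = 0 then 2 * n else x) \<in> B \<inter> ?A" using ends B(1) n by auto
      have "B \<inter> ?A = ?A"
      proof (rule transitive_onD[OF tr _ x])
        fix t y assume t: "t \<in> {f}" and y: "y \<in> B \<inter> ?A"
        have "f y \<in> B"
        proof (cases "y = 2 * n")
          case True
          have "(0, partner D 1) \<in> ?G" unfolding G using n by force
          then show ?thesis using step True y ends by (auto simp: f_def nxt_def)
        next
          case False
          then have "Suc y \<in> ?A" using y by auto
          then have "(Suc y - 1, partner D (Suc y)) \<in> ?G" unfolding G by blast
          then show ?thesis using step False y by (auto simp: f_def nxt_def)
        qed
        then show "t y \<in> B \<inter> ?A" using t fA y by auto
      qed auto
      then have "?A \<subseteq> B" by blast
      moreover from this have "0 \<in> B" using ends n by auto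
      moreover have "?C = insert 0 ?A" by auto
      ultimately have "?C \<subseteq> B" by simp
      with B(1) show "B = ?C" by (rule subset_antisym)
    qed
  qed
  finally show ?thesis unfolding f_def nxt_def .
qed

section \<open>Reflection symmetry and maximality in terms of involutions\<close>

lemma reflection_image_iff:
  assumes D: "chord_diagram (2 * g) D"
  shows "(\<lambda>c. reflection g ` c) ` D = D \<longleftrightarrow>
    (\<forall>i\<in>{1..4 * g}. partner D (reflection g i) = reflection g (partner D i))"
proof
  assume sym: "(\<lambda>c. reflection g ` c) ` D = D"
  show "\<forall>i\<in>{1..4 * g}. partner D (reflection g i) = reflection g (partner D i)"
  proof
    fix i assume "i \<in> {1..4 * g}"
    then have "{i, partner D i} \<in> D" using chord_iff_partner[OF D] by simp
    then have "reflection g ` {i, partner D i} \<in> D" using sym by blast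
    then have "{reflection g i, reflection g (partner D i)} \<in> D" by simp
    then show "partner D (reflection g i) = reflection g (partner D i)"
      using chord_iff_partner[OF D] by metis
  qed
next
  assume comm: "\<forall>i\<in>{1..4 * g}. partner D (reflection g i) = reflection g (partner D i)"
  have r: "reflection g i \<in> {1..4 * g}" "reflection g (reflection g i) = i" if "i \<in> {1..4 * g}" for i
    using involution_on_reflections(1)[of g] that by (auto simp: involution_on_def)
  have eq: "D = (\<lambda>i. {i, partner D i}) ` {1..4 * g}"
    using chord_diagram_eq_image_partner[OF D] by simp
  have "(\<lambda>c. reflection g ` c) ` D = (\<lambda>i. reflection g ` {i, partner D i}) ` {1..4 * g}"
    by (subst eq) (simp add: image_image)
  also have "\<dots> = (\<lambda>i. {i, partner D i}) ` reflection g ` {1..4 * g}"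
    using comm by (simp add: image_image)
  also have "reflection g ` {1..4 * g} = {1..4 * g}"
  proof (intro equalityI image_subsetI subsetI)
    fix i assume "i \<in> {1..4 * g}"
    then show "i \<in> reflection g ` {1..4 * g}" using r[of i] by (metis image_eqI)
  qed (use r in blast)
  finally show "(\<lambda>c. reflection g ` c) ` D = D" using eq by simp
qed

text \<open>For \<open>2 * g\<close> edges and one face, genus \<open>g\<close> means
  \<open>V - 2g + 1 = 2 - 2g\<close>, that is \<open>V = 1\<close>. The walk around this vertex is
  \<open>partner D\<close> after the rotation, and the rotation is
  \<open>reflection g \<circ> corner_reflection g\<close>.\<close>

lemma type_II_iff:
  assumes g: "g > 0"
  shows "D \<in> type_II_maximal_diagrams g \<longleftrightarrow>
    chord_diagram (2 * g) D \<and>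
    (\<forall>i\<in>{1..4 * g}. partner D (reflection g i) = reflection g (partner D i)) \<and>
    transitive_on {1..4 * g} {partner D \<circ> reflection g \<circ> corner_reflection g}"
proof -
  have cong: "transitive_on A {f} \<longleftrightarrow> transitive_on A {h}" if "\<And>x. x \<in> A \<Longrightarrow> f x = h x"
    for A :: "nat set" and f h
  proof -
    have "f ` B = h ` B" if "B \<subseteq> A" for B
      using \<open>\<And>x. x \<in> A \<Longrightarrow> f x = h x\<close> that by (intro image_cong) auto
    then show ?thesis unfolding transitive_on_def by simp
  qed
  have "has_genus (2 * g) D g \<longleftrightarrow> card (glued_vertices (2 * g) D) = 1"
    by (auto simp: has_genus_def)
  moreover have "card (glued_vertices (2 * g) D) = 1 \<longleftrightarrow>
      transitive_on {1..4 * g} {partner D \<circ> reflection g \<circ> corner_reflection g}"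
    if D: "chord_diagram (2 * g) D"
  proof -
    have "card (glued_vertices (2 * g) D) = 1 \<longleftrightarrow>
        transitive_on {1..4 * g} {\<lambda>c. partner D (if c = 4 * g then 1 else Suc c)}"
      using card_glued_vertices_eq_1[OF D] g by simp
    also have "\<dots> \<longleftrightarrow> transitive_on {1..4 * g} {partner D \<circ> reflection g \<circ> corner_reflection g}"
      by (rule cong) (simp add: reflection_corner_reflection)
    finally show ?thesis .
  qed
  ultimately show ?thesis
    unfolding type_II_maximal_diagrams_def maximal_diagram_def
    using reflection_image_iff[of g D] by (simp only: mem_Collect_eq) blast
qed

section \<open>Rooted maps\<close>

lemma rooted_map_iso_sym:
  assumes R: "is_rooted_map R" and S: "is_rooted_map S" and iso: "rooted_map_iso R S"
  shows "rooted_map_iso S R"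
proof -
  obtain M x where Mx: "R = (M, x)" by (cases R)
  obtain N y where Ny: "S = (N, y)" by (cases S)
  obtain h where h: "bij_betw h (flags M) (flags N)" "h x = y"
    and hom: "\<And>z. z \<in> flags M \<Longrightarrow> h (other_end M z) = other_end N (h z) \<and>
      h (other_dir M z) = other_dir N (h z) \<and> h (other_side M z) = other_side N (h z)"
    using iso by (auto simp: rooted_map_iso_def Mx Ny)
  let ?k = "inv_into (flags M) h"
  have k: "bij_betw ?k (flags N) (flags M)" using h(1) by (rule bij_betw_inv_into)
  have kh: "?k (h z) = z" if "z \<in> flags M" for z using bij_betw_inv_into_left[OF h(1) that] .
  have hk: "h (?k z) = z" if "z \<in> flags N" for z using bij_betw_inv_into_right[OF h(1) that] .
  have kM: "?k z \<in> flags M" if "z \<in> flags N" for z using bij_betwE[OF k] that by blast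
  have cl: "other_end M z \<in> flags M" "other_dir M z \<in> flags M" "other_side M z \<in> flags M"
    if "z \<in> flags M" for z
    using R that by (auto simp: is_rooted_map_def is_map_def involution_on_def Mx)
  have "?k (other_end N z) = other_end M (?k z) \<and> ?k (other_dir N z) = other_dir M (?k z) \<and>
      ?k (other_side N z) = other_side M (?k z)" if "z \<in> flags N" for z
    using hom[OF kM[OF that]] hk[OF that] kh cl[OF kM[OF that]] by metis
  moreover have "?k y = x" using kh[of x] h(2) R by (auto simp: is_rooted_map_def Mx)
  ultimately show ?thesis using k by (auto simp: rooted_map_iso_def Mx Ny)
qed

lemma rooted_map_iso_trans:
  assumes "rooted_map_iso R S" "rooted_map_iso S T"
  shows "rooted_map_iso R T"
proof -
  obtain h where h: "bij_betw h (flags (fst R)) (flags (fst S))" "h (snd R) = snd S"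
    "\<And>z. z \<in> flags (fst R) \<Longrightarrow> h (other_end (fst R) z) = other_end (fst S) (h z) \<and>
      h (other_dir (fst R) z) = other_dir (fst S) (h z) \<and>
      h (other_side (fst R) z) = other_side (fst S) (h z)"
    using assms(1) by (auto simp: rooted_map_iso_def Let_def)
  obtain k where k: "bij_betw k (flags (fst S)) (flags (fst T))" "k (snd S) = snd T"
    "\<And>z. z \<in> flags (fst S) \<Longrightarrow> k (other_end (fst S) z) = other_end (fst T) (k z) \<and>
      k (other_dir (fst S) z) = other_dir (fst T) (k z) \<and>
      k (other_side (fst S) z) = other_side (fst T) (k z)"
    using assms(2) by (auto simp: rooted_map_iso_def Let_def)
  show ?thesis
    unfolding rooted_map_iso_def Let_def
  proof (intro exI[of _ "k \<circ> h"] conjI ballI)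
    show "bij_betw (k \<circ> h) (flags (fst R)) (flags (fst T))" using h(1) k(1) by (rule bij_betw_trans)
    show "(k \<circ> h) (snd R) = snd T" using h(2) k(2) by simp
    fix z assume z: "z \<in> flags (fst R)"
    then have "h z \<in> flags (fst S)" using bij_betwE[OF h(1)] by blast
    then show "(k \<circ> h) (other_end (fst R) z) = other_end (fst T) ((k \<circ> h) z)"
      "(k \<circ> h) (other_dir (fst R) z) = other_dir (fst T) ((k \<circ> h) z)"
      "(k \<circ> h) (other_side (fst R) z) = other_side (fst T) ((k \<circ> h) z)"
      using h(3)[OF z] k(3) by simp_all
  qed
qed

lemma equiv_rooted_map_iso:
  "equiv (rooted_map_reps v e f)
    {(R, S). R \<in> rooted_map_reps v e f \<and> S \<in> rooted_map_reps v e f \<and> rooted_map_iso R S}"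
proof (rule equivI)
  show "refl_on (rooted_map_reps v e f)
      {(R, S). R \<in> rooted_map_reps v e f \<and> S \<in> rooted_map_reps v e f \<and> rooted_map_iso R S}"
    by (rule refl_onI) (auto simp: rooted_map_iso_def Let_def intro!: exI[of _ id])
  show "sym {(R, S). R \<in> rooted_map_reps v e f \<and> S \<in> rooted_map_reps v e f \<and> rooted_map_iso R S}"
    by (rule symI) (auto simp: rooted_map_reps_def intro: rooted_map_iso_sym)
  show "trans {(R, S). R \<in> rooted_map_reps v e f \<and> S \<in> rooted_map_reps v e f \<and> rooted_map_iso R S}"
    by (rule transI) (auto intro: rooted_map_iso_trans)
qed auto

text \<open>Orbit counts equal to one become transitivity, and each edge has exactly four flags, so
  \<open>g\<close> edges mean \<open>4 * g\<close> flags. The degenerate alternative in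
  \<open>is_map\<close> would leave no edges, against \<open>g > 0\<close>. In the converse
  direction, connectedness follows from having one face.\<close>

lemma rooted_map_reps_one_vertex_one_face:
  assumes g: "g > 0"
  shows "(M, x) \<in> rooted_map_reps 1 g 1 \<longleftrightarrow>
    card (flags M) = 4 * g \<and> x \<in> flags M \<and>
    involution_on (flags M) (other_end M) \<and>
    involution_on (flags M) (other_dir M) \<and>
    involution_on (flags M) (other_side M) \<and>
    (\<forall>x\<in>flags M. other_end M (other_side M x) = other_side M (other_end M x)) \<and>
    (\<forall>x\<in>flags M. other_dir M x \<noteq> x) \<and>
    (\<forall>x\<in>flags M. other_end M x \<noteq> x \<and> other_side M x \<noteq> x \<and> other_end M (other_side M x) \<noteq> x) \<and>
    transitive_on (flags M) {other_dir M, other_side M} \<and>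
    transitive_on (flags M) {other_end M, other_dir M}"
    (is "?lhs \<longleftrightarrow> ?rhs")
proof -
  let ?F = "flags M" and ?a = "other_end M" and ?b = "other_dir M" and ?t = "other_side M"
  have orb: "card (orbits ?F {?b, ?t}) = 1 \<longleftrightarrow> transitive_on ?F {?b, ?t}"
    "card (orbits ?F {?a, ?b}) = 1 \<longleftrightarrow> transitive_on ?F {?a, ?b}"
    "card (orbits ?F {?a, ?b, ?t}) = 1 \<longleftrightarrow> transitive_on ?F {?a, ?b, ?t}"
    if "involution_on ?F ?a" "involution_on ?F ?b" "involution_on ?F ?t"
    using that by (intro card_orbits_eq_1; auto)+
  have edges: "card ?F = 4 * card (map_edges M)"
    if "finite ?F" "involution_on ?F ?a" "involution_on ?F ?t"
      "\<forall>x\<in>?F. ?a (?t x) = ?t (?a x)" "\<forall>x\<in>?F. ?a x \<noteq> x \<and> ?t x \<noteq> x \<and> ?a (?t x) \<noteq> x"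
  proof -
    have "{x \<in> ?F. ?a x \<noteq> x} = ?F" using that(5) by blast
    then show ?thesis unfolding map_edges_def using card_eq_4_mult_card_orbits[of ?F ?a ?t] that by simp
  qed
  show ?thesis
  proof
    assume L: ?lhs
    then have M: "is_map M" "x \<in> ?F" and c: "card (map_vertices M) = 1" "card (map_edges M) = g"
      "card (map_faces M) = 1"
      by (auto simp: rooted_map_reps_def is_rooted_map_def)
    have "\<not> (\<forall>x\<in>?F. ?a x = x)"
    proof
      assume "\<forall>x\<in>?F. ?a x = x"
      then have "{x \<in> ?F. ?a x \<noteq> x} = {}" by blast
      then have "map_edges M = {}" by (simp only: map_edges_def orbits_def quotient_empty)
      then show False using c(2) g by simp
    qed
    then have free: "\<forall>x\<in>?F. ?a x \<noteq> x \<and> ?t x \<noteq> x \<and> ?a (?t x) \<noteq> x"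
      using M(1) unfolding is_map_def by blast
    show ?rhs
      using M c free orb edges unfolding is_map_def map_vertices_def map_faces_def by simp
  next
    assume R: ?rhs
    then have fin: "finite ?F" using g by (metis card.infinite mult_is_0 neq0_conv zero_neq_numeral)
    moreover have "card ?F = 4 * card (map_edges M)" by (rule edges) (use fin R in blast)+
    then have "card (map_edges M) = g" using R by simp
    moreover have "transitive_on ?F {?a, ?b, ?t}"
      by (rule transitive_on_mono[of _ "{?a, ?b}"]) (use R in auto)
    ultimately show ?lhs
      using R orb
      unfolding rooted_map_reps_def is_rooted_map_def is_map_def map_vertices_def map_faces_def
      by auto
  qed
qed

section \<open>From diagrams to rooted maps\<close>

definition diagram_map :: "nat \<Rightarrow> nat set set \<Rightarrow> nat surface_map" where
  "diagram_map g D = \<lparr>flags = {1..4 * g}, other_end = reflection g, other_dir = corner_dir g,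
     other_side = partner D \<circ> reflection g\<rparr>"

text \<open>The symmetry of the diagram makes \<open>partner D \<circ> reflection g\<close> an
  involution commuting with the reflection. Its product with the reflection is
  \<open>partner D\<close>, which is free of fixed points because chords have two ends. Maximality
  yields the single vertex and, through \<open>fixed_point_free_if_transitive\<close>, that
  \<open>other_side\<close> has no fixed points either.\<close>

lemma diagram_map_in_reps:
  assumes g: "g > 0" and D: "D \<in> type_II_maximal_diagrams g"
  shows "(diagram_map g D, 4 * g) \<in> rooted_map_reps 1 g 1"
proof -
  let ?I = "{1..4 * g}" and ?r = "reflection g" and ?s = "corner_reflection g"
  let ?p = "partner D"
  let ?t = "?p \<circ> ?r"
  have chord: "chord_diagram (2 * g) D" and comm: "\<And>i. i \<in> ?I \<Longrightarrow> ?p (?r i) = ?r (?p i)"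
    and trans: "transitive_on ?I {?t \<circ> ?s}"
    using D type_II_iff[OF g] by (auto simp: comp_assoc)
  have r: "?r i \<in> ?I" "?r (?r i) = i" if "i \<in> ?I" for i
    using involution_on_reflections(1)[of g] that unfolding involution_on_def by blast+
  have p: "?p i \<in> ?I" "?p (?p i) = i" if "i \<in> ?I" for i
    using involution_on_partner[OF chord] that unfolding involution_on_def by auto
  have t: "involution_on ?I ?t"
    unfolding involution_on_def
  proof
    fix i assume i: "i \<in> ?I"
    have "?p (?r (?p (?r i))) = ?p (?r (?r (?p i)))" using comm[OF i] by simp
    also have "\<dots> = i" using r(2)[OF p(1)[OF i]] p(2)[OF i] by simp
    finally show "?t i \<in> ?I \<and> ?t (?t i) = i" using p(1)[OF r(1)[OF i]] by simp
  qed
  have "?t i \<noteq> i" if "i \<in> ?I" for i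
    by (rule fixed_point_free_if_transitive[of ?I ?s ?t "4 * g"])
      (use that g trans t involution_on_reflections(2)[of g] in \<open>auto simp: corner_reflection_def\<close>)
  moreover have "?r (?t i) \<noteq> i" if "i \<in> ?I" for i
    using comm[OF r(1)[OF that]] r(2)[OF that] partner_neq[OF chord, of i] that by simp
  moreover have "?r (?t i) = ?t (?r i)" if "i \<in> ?I" for i
    using comm[OF r(1)[OF that]] by simp
  moreover have "transitive_on ?I {corner_dir g, ?t}"
  proof (rule transitive_onI)
    fix B x
    assume B: "B \<subseteq> ?I" "x \<in> B" and cl: "\<And>u y. u \<in> {corner_dir g, ?t} \<Longrightarrow> y \<in> B \<Longrightarrow> u y \<in> B"
    show "B = ?I"
    proof (rule transitive_onD[OF trans B])
      fix u y assume u: "u \<in> {?t \<circ> ?s}" and y: "y \<in> B"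
      have "?s y \<in> B" using cl[of "corner_dir g" y] y by (simp add: corner_reflection_cases)
      then show "u y \<in> B" using cl[of ?t "?s y"] u by simp
    qed
  qed (use g in auto)
  ultimately show ?thesis
    unfolding rooted_map_reps_one_vertex_one_face[OF g] diagram_map_def
    using involution_on_reflections[of g] t g transitive_on_reflection_corner_dir[OF g]
      reflection_neq corner_dir_neq
    by simp
qed

text \<open>Both maps share \<open>reflection g\<close>, \<open>corner_dir g\<close> and the root.
  An isomorphism commutes with this transitive pair and fixes the root, so it is the identity on the
  labels; then the two partner functions agree.\<close>

lemma diagram_map_iso_imp_eq:
  assumes g: "g > 0" and D: "D \<in> type_II_maximal_diagrams g" and E: "E \<in> type_II_maximal_diagrams g"
    and iso: "rooted_map_iso (diagram_map g D, 4 * g) (diagram_map g E, 4 * g)"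
  shows "D = E"
proof -
  let ?I = "{1..4 * g}" and ?r = "reflection g"
  have chord: "chord_diagram (2 * g) D" "chord_diagram (2 * g) E"
    using D E type_II_iff[OF g] by blast+
  obtain h where h: "h (4 * g) = 4 * g"
    "\<And>i. i \<in> ?I \<Longrightarrow> h (?r i) = ?r (h i)"
    "\<And>i. i \<in> ?I \<Longrightarrow> h (corner_dir g i) = corner_dir g (h i)"
    "\<And>i. i \<in> ?I \<Longrightarrow> h (partner D (?r i)) = partner E (?r (h i))"
    using iso by (auto simp: rooted_map_iso_def diagram_map_def)
  have "{i \<in> ?I. h i = i} = ?I"
  proof (rule transitive_onD[OF transitive_on_reflection_corner_dir[OF g]])
    show "4 * g \<in> {i \<in> ?I. h i = i}" using g h(1) by simp
    fix t i assume "t \<in> {?r, corner_dir g}" "i \<in> {i \<in> ?I. h i = i}"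
    then show "t i \<in> {i \<in> ?I. h i = i}"
      using h(2,3) involution_on_reflections[of g] unfolding involution_on_def by auto
  qed auto
  then have id: "h i = i" if "i \<in> ?I" for i using that by blast
  have "partner D i = partner E i" if i: "i \<in> ?I" for i
  proof -
    have r: "?r i \<in> ?I" "?r (?r i) = i"
      using involution_on_reflections(1)[of g] i unfolding involution_on_def by blast+
    have "partner D i \<in> ?I" using involution_on_partner[OF chord(1)] i by (simp add: involution_on_def)
    then show ?thesis using h(4)[OF r(1)] id r by simp
  qed
  then have "(\<lambda>i. {i, partner D i}) ` ?I = (\<lambda>i. {i, partner E i}) ` ?I" by (intro image_cong) auto
  then show ?thesis
    using chord_diagram_eq_image_partner[OF chord(1)] chord_diagram_eq_image_partner[OF chord(2)]
    by simp
qed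

section \<open>From rooted maps back to diagrams\<close>

lemma transitive_on_transport:
  assumes tr: "transitive_on A T" and h: "bij_betw h A B"
    and U: "\<And>t. t \<in> T \<Longrightarrow> \<exists>u\<in>U. \<forall>x\<in>A. t x \<in> A \<and> h (t x) = u (h x)"
  shows "transitive_on B U"
proof (rule transitive_onI)
  show "B \<noteq> {}" using tr h bij_betw_empty1 unfolding transitive_on_def bij_betw_def by auto
  fix C y assume C: "C \<subseteq> B" "y \<in> C" and cl: "\<And>u y. u \<in> U \<Longrightarrow> y \<in> C \<Longrightarrow> u y \<in> C"
  have B: "B = h ` A" using h by (simp add: bij_betw_def)
  then obtain x where x: "x \<in> A" "h x = y" using C by auto
  have "{x \<in> A. h x \<in> C} = A"
  proof (rule transitive_onD[OF tr])
    show "x \<in> {x \<in> A. h x \<in> C}" using x C by simp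
    fix t z assume t: "t \<in> T" and z: "z \<in> {x \<in> A. h x \<in> C}"
    then obtain u where "u \<in> U" "t z \<in> A" "h (t z) = u (h z)" using U[OF t] by auto
    then show "t z \<in> {x \<in> A. h x \<in> C}" using cl z by simp
  qed auto
  then show "C = B" using B C(1) by auto
qed

text \<open>Labelling the flags around the face turns \<open>other_end\<close> and
  \<open>other_dir\<close> into the model pair and \<open>other_side\<close> into an involution
  \<open>q\<close> of the labels, from which the chords are read off. For maximality, the one vertex
  allows a second labelling \<open>w\<close>, which conjugates \<open>reflection g\<close> to
  \<open>q\<close> and preserves \<open>corner_dir g\<close>. It carries the rotation to the vertex
  walk of the diagram, which is therefore transitive too.\<close>

lemma rooted_map_iso_diagram_map:
  assumes g: "g > 0" and R: "R \<in> rooted_map_reps 1 g 1"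
  shows "\<exists>D\<in>type_II_maximal_diagrams g. rooted_map_iso (diagram_map g D, 4 * g) R"
proof -
  obtain M x where Mx: "R = (M, x)" by (cases R)
  define F a b t where "F = flags M" and "a = other_end M" and "b = other_dir M" and "t = other_side M"
  let ?I = "{1..4 * g}" and ?r = "reflection g" and ?s = "corner_reflection g" and ?d = "corner_dir g"
  have M: "card F = 4 * g" "x \<in> F" "involution_on F a" "involution_on F b" "involution_on F t"
    "\<And>x. x \<in> F \<Longrightarrow> a (t x) = t (a x)" "\<And>x. x \<in> F \<Longrightarrow> a x \<noteq> x" "\<And>x. x \<in> F \<Longrightarrow> b x \<noteq> x"
    "\<And>x. x \<in> F \<Longrightarrow> t x \<noteq> x" "\<And>x. x \<in> F \<Longrightarrow> a (t x) \<noteq> x"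
    "transitive_on F {b, t}" "transitive_on F {a, b}"
    using R unfolding Mx rooted_map_reps_one_vertex_one_face[OF g] F_def a_def b_def t_def by blast+
  obtain h where h: "bij_betw h ?I F" "h (4 * g) = x"
    "\<And>i. i \<in> ?I \<Longrightarrow> h (?r i) = a (h i)" "\<And>i. i \<in> ?I \<Longrightarrow> h (?d i) = b (h i)"
    using cyclic_labelling[OF g M(1,3,4,7,8,12,2)] by blast
  define k where "k = inv_into ?I h"
  have k: "bij_betw k F ?I" unfolding k_def using h(1) by (rule bij_betw_inv_into)
  have kh: "k (h i) = i" if "i \<in> ?I" for i unfolding k_def using bij_betw_inv_into_left[OF h(1) that] .
  have hk: "h (k y) = y" if "y \<in> F" for y unfolding k_def using bij_betw_inv_into_right[OF h(1) that] .
  have hF: "h i \<in> F" if "i \<in> ?I" for i using bij_betwE[OF h(1)] that by blast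
  have kI: "k y \<in> ?I" if "y \<in> F" for y using bij_betwE[OF k] that by blast
  have r: "?r i \<in> ?I" "?r (?r i) = i" if "i \<in> ?I" for i
    using involution_on_reflections(1)[of g] that unfolding involution_on_def by blast+
  have d: "?d i \<in> ?I" if "i \<in> ?I" for i
    using involution_on_reflections(3)[of g] that unfolding involution_on_def by blast
  have tF: "t y \<in> F" "t (t y) = y" if "y \<in> F" for y
    using M(5) that unfolding involution_on_def by blast+
  have bF: "b y \<in> F" if "y \<in> F" for y using M(4) that unfolding involution_on_def by blast

  define q where "q i = k (t (h i))" for i
  have hq: "h (q i) = t (h i)" if "i \<in> ?I" for i unfolding q_def using hk[OF tF(1)[OF hF[OF that]]] .
  have qI: "q i \<in> ?I" if "i \<in> ?I" for i unfolding q_def using kI[OF tF(1)[OF hF[OF that]]] .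
  have inj: "i = j" if "h i = h j" "i \<in> ?I" "j \<in> ?I" for i j
    using inj_onD[OF bij_betw_imp_inj_on[OF h(1)] that] .
  have qq: "q (q i) = i" if "i \<in> ?I" for i
  proof (rule inj)
    show "h (q (q i)) = h i"
      using hq[OF qI[OF that]] hq[OF that] tF(2)[OF hF[OF that]] by simp
  qed (use qI that in blast)+
  have q: "involution_on ?I q" using qI qq unfolding involution_on_def by blast
  have qr: "?r (q i) = q (?r i)" if "i \<in> ?I" for i
  proof (rule inj)
    show "h (?r (q i)) = h (q (?r i))"
      using h(3)[OF qI[OF that]] hq[OF that] hq[OF r(1)[OF that]] h(3)[OF that] M(6)[OF hF[OF that]]
      by simp
  qed (use qI r that in blast)+
  have q_neq: "q i \<noteq> i" if "i \<in> ?I" for i using hq[OF that] M(9)[OF hF[OF that]] by auto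

  \<comment> \<open>Solves \<open>q = p \<circ> reflection g\<close> for \<open>p\<close>. That no
    chord degenerates to a point is the condition that \<open>other_end\<close> after
    \<open>other_side\<close> moves every flag.\<close>
  define p where "p i = q (?r i)" for i
  have p: "involution_on {1..2 * (2 * g)} p"
    unfolding involution_on_def p_def using qI qq qr r by simp
  have p_neq: "p i \<noteq> i" if "i \<in> {1..2 * (2 * g)}" for i
  proof
    have i: "i \<in> ?I" using that by simp
    assume "p i = i"
    then have "?r (q i) = i" using qr[OF i] by (simp add: p_def)
    then have "a (t (h i)) = h i" using h(3)[OF qI[OF i]] hq[OF i] by simp
    then show False using M(10)[OF hF[OF i]] by simp
  qed
  define D where "D = (\<lambda>i. {i, p i}) ` {1..2 * (2 * g)}"
  have chord: "chord_diagram (2 * g) D"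
    unfolding D_def by (rule chord_diagram_of_involution(1)[OF p p_neq])
  have partner: "partner D i = q (?r i)" if "i \<in> ?I" for i
    using chord_diagram_of_involution(2)[OF p p_neq, of i] that by (simp add: D_def p_def)

  have "transitive_on ?I {?d, q}"
  proof (rule transitive_on_transport[OF M(11) k])
    fix u assume u: "u \<in> {b, t}"
    show "\<exists>v\<in>{?d, q}. \<forall>y\<in>F. u y \<in> F \<and> k (u y) = v (k y)"
    proof (cases "u = b")
      case True
      have "k (b y) = ?d (k y)" if "y \<in> F" for y
        using kh[OF d[OF kI[OF that]]] h(4)[OF kI[OF that]] hk[OF that] by simp
      then show ?thesis using True bF by blast
    next
      case False
      have "k (t y) = q (k y)" if "y \<in> F" for y unfolding q_def using hk[OF that] by simp
      then show ?thesis using False u tF by blast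
    qed
  qed
  then have "transitive_on ?I {q, ?d}" by (simp add: insert_commute)
  then obtain w where w: "bij_betw w ?I ?I" "w (4 * g) = 4 * g"
    "\<And>i. i \<in> ?I \<Longrightarrow> w (?r i) = q (w i)" "\<And>i. i \<in> ?I \<Longrightarrow> w (?d i) = ?d (w i)"
    using cyclic_labelling[OF g _ q involution_on_reflections(3) q_neq corner_dir_neq, of "4 * g"] g
    by auto
  have wI: "w i \<in> ?I" if "i \<in> ?I" for i using bij_betwE[OF w(1)] that by blast
  \<comment> \<open>The axis corner \<open>2 * g\<close> is the image of the root under
    \<open>corner_dir g\<close>, so \<open>w\<close> fixes both axis corners. By injectivity it
    keeps all other labels off the axis, where \<open>corner_dir\<close> and
    \<open>corner_reflection\<close> agree; hence \<open>w\<close> commutes with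
    \<open>corner_reflection\<close> as well.\<close>
  have w2g: "w (2 * g) = 2 * g" using w(4)[of "4 * g"] w(2) g by (simp add: corner_dir_def)
  have ws: "w (?s i) = ?s (w i)" if i: "i \<in> ?I" for i
  proof (cases "i = 2 * g \<or> i = 4 * g")
    case True
    then show ?thesis using w2g w(2) by (auto simp: corner_reflection_cases)
  next
    case False
    have "2 * g \<in> ?I" "4 * g \<in> ?I" using g by auto
    then have "w i \<noteq> 2 * g" "w i \<noteq> 4 * g"
      using False i w2g w(2) bij_betw_imp_inj_on[OF w(1)] by (metis inj_onD)+
    then show ?thesis using False w(4)[OF i] by (simp add: corner_reflection_cases)
  qed
  have s: "?s i \<in> ?I" if "i \<in> ?I" for i
    using involution_on_reflections(2)[of g] that unfolding involution_on_def by blast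
  have "transitive_on ?I {partner D \<circ> ?r \<circ> ?s}"
  proof (rule transitive_on_transport[OF transitive_on_rotation[OF g] w(1)])
    fix u assume u: "u \<in> {?r \<circ> ?s}"
    have "w (?r (?s i)) = partner D (?r (?s (w i)))" if i: "i \<in> ?I" for i
      using w(3)[OF s[OF i]] ws[OF i] partner[OF r(1)[OF s[OF wI[OF i]]]] r(2)[OF s[OF wI[OF i]]]
      by simp
    then show "\<exists>v\<in>{partner D \<circ> ?r \<circ> ?s}. \<forall>i\<in>?I. u i \<in> ?I \<and> w (u i) = v (w i)"
      using u r(1)[OF s] by simp
  qed
  moreover have "partner D (?r i) = ?r (partner D i)" if "i \<in> ?I" for i
    using partner[OF that] partner[OF r(1)[OF that]] r[OF that] qr[OF r(1)[OF that]] by simp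
  ultimately have "D \<in> type_II_maximal_diagrams g" using type_II_iff[OF g] chord by blast
  moreover have "h (partner D (?r i)) = t (h i)" if "i \<in> ?I" for i
    using partner[OF r(1)[OF that]] r(2)[OF that] hq[OF that] by simp
  then have "rooted_map_iso (diagram_map g D, 4 * g) R"
    unfolding rooted_map_iso_def Mx diagram_map_def Let_def
    using h unfolding F_def a_def b_def t_def by (intro exI[of _ h]) simp
  ultimately show ?thesis by blast
qed

section \<open>The bijection\<close>

text \<open>For \<open>g = 0\<close> the label set \<open>{1..4 * g}\<close> is empty, whereas the
  map without edges has two flags. It therefore needs a model of its own.\<close>

definition vertex_map :: "nat surface_map" where
  "vertex_map = \<lparr>flags = {0, 1}, other_end = id, other_dir = (\<lambda>i. 1 - i), other_side = id\<rparr>"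

lemma vertex_map_in_reps: "(vertex_map, 0) \<in> rooted_map_reps 1 0 1"
proof -
  have inv: "involution_on {0, Suc 0} id" "involution_on {0, Suc 0} ((-) (Suc 0))"
    by (auto simp: involution_on_def)
  have tr: "transitive_on {0, Suc 0} T" if "(-) (Suc 0) \<in> T" for T
  proof (rule transitive_onI)
    fix B x assume B: "B \<subseteq> {0, Suc 0}" "x \<in> B" and cl: "\<And>t y. t \<in> T \<Longrightarrow> y \<in> B \<Longrightarrow> t y \<in> B"
    have "Suc 0 - x \<in> B" using cl[OF that B(2)] .
    then show "B = {0, Suc 0}" using B by auto
  qed simp
  have "card (orbits {0, Suc 0} T) = 1" if "T \<subseteq> {id, (-) (Suc 0)}" "(-) (Suc 0) \<in> T" for T
    by (subst card_orbits_eq_1) (use that inv tr in auto)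
  then show ?thesis
    using inv
    by (simp add: rooted_map_reps_def is_rooted_map_def is_map_def vertex_map_def
        map_vertices_def map_edges_def map_faces_def orbits_def[of "{}"])
qed

text \<open>Without edges \<open>other_end\<close> moves no flag, so the degenerate alternative of
  \<open>is_map\<close> holds and \<open>other_side\<close> is the identity as well. By
  connectedness the root and its image under \<open>other_dir\<close> are the only flags.\<close>

lemma rooted_map_iso_vertex_map:
  assumes R: "R \<in> rooted_map_reps 1 0 1"
  shows "rooted_map_iso (vertex_map, 0) R"
proof -
  obtain M x where Mx: "R = (M, x)" by (cases R)
  let ?F = "flags M" and ?a = "other_end M" and ?b = "other_dir M" and ?t = "other_side M"
  have M: "is_map M" "x \<in> ?F" and e: "card (map_edges M) = 0"
    using R by (auto simp: rooted_map_reps_def is_rooted_map_def Mx)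
  have inv: "involution_on ?F ?a" "involution_on ?F ?b" "involution_on ?F ?t"
    and bx: "?b x \<noteq> x" and fin: "finite ?F"
    using M unfolding is_map_def by auto
  \<comment> \<open>Excludes that the cardinality \<open>0\<close> is merely the default value for
    an infinite set.\<close>
  have "finite (map_edges M)"
    unfolding map_edges_def orbits_def quotient_def using fin by simp
  then have "map_edges M = {}" using e by simp
  then have "\<forall>y\<in>?F. ?a y = y"
    unfolding map_edges_def orbits_def quotient_def by auto
  then have id: "\<And>y. y \<in> ?F \<Longrightarrow> ?a y = y \<and> ?t y = y"
    using M unfolding is_map_def by blast
  have b: "?b x \<in> ?F" "?b (?b x) = x" using inv(2) M(2) unfolding involution_on_def by auto
  have "card (orbits ?F {?a, ?b, ?t}) = 1" using M(1) by (simp add: is_map_def)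
  then have tr: "transitive_on ?F {?a, ?b, ?t}"
    by (subst (asm) card_orbits_eq_1) (use inv in auto)
  have F: "{x, ?b x} = ?F"
    by (rule transitive_onD[OF tr, where x = x]) (use M(2) b id in auto)
  define h where "h i = (if i = 0 then x else ?b x)" for i :: nat
  have "bij_betw h {0, 1} ?F"
    using bx F by (auto simp: bij_betw_def inj_on_def h_def)
  then show ?thesis
    unfolding rooted_map_iso_def Mx vertex_map_def Let_def
    using id M(2) b by (intro exI[of _ h]) (auto simp: h_def)
qed

text \<open>Reduces a bijection onto isomorphism classes to two facts about chosen representatives:
  related representatives have equal indices, and every element is related to some
  representative.\<close>

lemma bij_betw_representatives:
  assumes eq: "equiv A r" and f: "f ` B \<subseteq> A"
    and inj: "\<And>x y. x \<in> B \<Longrightarrow> y \<in> B \<Longrightarrow> (f x, f y) \<in> r \<Longrightarrow> x = y"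
    and surj: "\<And>z. z \<in> A \<Longrightarrow> \<exists>x\<in>B. (f x, z) \<in> r"
  shows "bij_betw (\<lambda>x. r `` {f x}) B (A // r)"
  unfolding bij_betw_def
proof (intro conjI inj_onI equalityI image_subsetI subsetI)
  fix x y assume "x \<in> B" "y \<in> B" "r `` {f x} = r `` {f y}"
  then show "x = y" using inj eq_equiv_class[OF _ eq] f by blast
next
  fix x assume "x \<in> B"
  then show "r `` {f x} \<in> A // r" using f by (auto intro: quotientI)
next
  fix X assume "X \<in> A // r"
  then obtain z where "z \<in> A" "X = r `` {z}" by (rule quotientE)
  then show "X \<in> (\<lambda>x. r `` {f x}) ` B" using surj equiv_class_eq[OF eq] by blast
qed

lemma type_II_maximal_diagrams_0: "type_II_maximal_diagrams 0 = {{}}"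
proof -
  \<comment> \<open>With no sides the corners \<open>0\<close> and \<open>2 * n\<close> coincide,
    and the single vertex gives \<open>1 - 0 + 1 = 2\<close>, the sphere.\<close>
  have "glued_vertices 0 {} = {{0}}"
    by (auto simp: glued_vertices_def corner_gluing_def quotient_def elim: rtrancl.cases)
  then have "has_genus 0 {} 0" by (simp add: has_genus_def)
  moreover have "chord_diagram 0 D \<longleftrightarrow> D = {}" for D
    by (auto simp: chord_diagram_def partition_on_def)
  ultimately show ?thesis
    unfolding type_II_maximal_diagrams_def maximal_diagram_def by auto
qed

theorem theorem1:
  fixes g :: nat
  shows "\<exists>\<Phi>. bij_betw \<Phi> (type_II_maximal_diagrams g) (rooted_maps 1 g 1)"
proof -
  let ?f = "\<lambda>D. if g = 0 then (vertex_map, 0) else (diagram_map g D, 4 * g)"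
  let ?r = "{(R, S). R \<in> rooted_map_reps 1 g 1 \<and> S \<in> rooted_map_reps 1 g 1 \<and> rooted_map_iso R S}"
  have in_reps: "?f D \<in> rooted_map_reps 1 g 1" if "D \<in> type_II_maximal_diagrams g" for D
    using vertex_map_in_reps diagram_map_in_reps that by auto
  have "bij_betw (\<lambda>D. ?r `` {?f D}) (type_II_maximal_diagrams g) (rooted_maps 1 g 1)"
    unfolding rooted_maps_def
  proof (rule bij_betw_representatives[OF equiv_rooted_map_iso])
    show "?f ` type_II_maximal_diagrams g \<subseteq> rooted_map_reps 1 g 1" using in_reps by blast
  next
    fix D E assume "D \<in> type_II_maximal_diagrams g" "E \<in> type_II_maximal_diagrams g" "(?f D, ?f E) \<in> ?r"
    then show "D = E"
      using diagram_map_iso_imp_eq[of g D E] type_II_maximal_diagrams_0 by (cases "g = 0") auto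
  next
    fix R assume R: "R \<in> rooted_map_reps 1 g 1"
    have "\<exists>D\<in>type_II_maximal_diagrams g. rooted_map_iso (?f D) R"
    proof (cases "g = 0")
      case True
      then show ?thesis using R rooted_map_iso_vertex_map type_II_maximal_diagrams_0 by simp
    next
      case False
      then show ?thesis using rooted_map_iso_diagram_map[of g R] R by simp
    qed
    then show "\<exists>D\<in>type_II_maximal_diagrams g. (?f D, R) \<in> ?r" using R in_reps by auto
  qed
  then show ?thesis by blast
qed

end
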